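(* Let $l_i(\eta)$, $i=1,2,3$, with $$\eta=\frac{a_1x_1+a_2x_2+a_3x_3}{b_1x_1+b_2x_2+b_3x_3},$$ be a solution of Lamé's system (with Guichard condition), i.e. a solution invariant under the 2-dimensional subgroup involving translations and dilations. Suppose that one of the pairs $(a_s,b_s)$ equals $(0,0)$. Then one of the following occurs: a) If $(a_1,b_1)=(0,0)$, then $l_1=\lambda_1$, $l_2=\lambda_1\cosh\varphi(\eta)$, $l_3=\lambda_1\sinh\varphi(\eta)$, where $\eta=\frac{a_2x_2+a_3x_3}{b_2x_2+b_3x_3}$ and $$\varphi(\eta)=\frac{C_0}{a_2b_3-a_3b_2}\arctan\left[\frac{b_2^2+b_3^2}{a_3b_2-a_2b_3}\left(\eta-\frac{a_2b_2+a_3b_3}{b_2^2+b_3^2}\right)\right]+C_1,$$ where $C_0,C_1\in\mathbb{R}$. b) If $(a_2,b_2)=(0,0)$, then $l_2=\lambda_2$, $l_1=\lambda_2\cos\varphi(\eta)$, $l_3=\lambda_2\sin\varphi(\eta)$, where $\eta=\frac{a_1x_1+a_3x_3}{b_1x_1+b_3x_3}$ and $\varphi$ is given as follows: b.1) if $b_1=b_3=b$, then $$\varphi(\eta)=\frac{D_0}{2b(a_3-a_1)}\log(2b\eta-a_1-a_3)+D_1,$$ where $D_0,D_1\in\mathbb{R}$; b.2) if $b_1\neq b_3$, then $$\varphi(\eta)=\frac{D_2}{2(a_1b_3-a_3b_1)}\log\left[\frac{(b_3+b_1)\eta-(a_3+a_1)}{(b_3-b_1)\eta-(a_3-a_1)}\right]+D_3,$$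 where $D_2,D_3\in\mathbb{R}$. c) If $(a_3,b_3)=(0,0)$, then $l_3=\lambda_3$, $l_2=\lambda_3\cosh\varphi(\eta)$, $l_1=\lambda_3\sinh\varphi(\eta)$, with $\eta=\frac{a_1x_1+a_2x_2}{b_1x_1+b_2x_2}$ and $$\varphi(\eta)=\frac{E_0}{a_2b_1-a_1b_2}\arctan\left[\frac{b_2^2+b_1^2}{a_2b_1-a_1b_2}\left(\eta-\frac{a_2b_2+a_1b_1}{b_2^2+b_1^2}\right)\right]+E_1,$$ where $E_0,E_1\in\mathbb{R}$. Here $\lambda_1,\lambda_2,\lambda_3$ denote real constants.
   Context: The vectors $(a_1,a_2,a_3)$ and $(b_1,b_2,b_3)$ in $\mathbb{R}^3$ are linearly independent, and one works on an open set where $b_1x_1+b_2x_2+b_3x_3\neq0$. Each $l_i$ is a smooth positive function of $\eta$ on an open interval, regarded as a function of $x=(x_1,x_2,x_3)$ (the $l_i$ are the coefficients $l_i=\sqrt{g(\partial_{x_i},\partial_{x_i})}$ of an orthogonal metric $g=\sum l_i^2dx_i^2$). Logarithms are understood as logarithms of the absolute value of their argument, on intervals of $\eta$ where the argument is defined and nonzero. Put $\varepsilon_1=\varepsilon_3=1$, $\varepsilon_2=-1$ and $h_{ij}=l_{i,x_j}/l_j$ for $i\ne j$ (subscripts $,x_j$ are partial derivatives). The functions are a solution of Lamé's system (with Guichard condition) if for all distinct $i,j,k\in\{1,2,3\}$: $$\varepsilon_i l_i^2+\varepsilon_j l_j^2+\varepsilon_k l_k^2=0\quad(\text{i.e. }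 l_1^2-l_2^2+l_3^2=0),$$ $$\varepsilon_i l_{i,x_i}+\varepsilon_j h_{ji}l_j+\varepsilon_k h_{ki}l_k=0,\qquad h_{ij,x_k}-h_{ik}h_{kj}=0,$$ $$h_{ij,x_j}+h_{ji,x_i}+h_{ik}h_{jk}=0,\qquad \varepsilon_i h_{ij,x_i}+\varepsilon_j h_{ji,x_j}+\varepsilon_k h_{ki}h_{kj}=0.$$ *)

theory Defs
  imports "HOL-Analysis.Analysis"
begin

definition partial_deriv :: "'n::finite \<Rightarrow> (real ^ 'n \<Rightarrow> real) \<Rightarrow> real ^ 'n \<Rightarrow> real" where
  "partial_deriv j F x = deriv (\<lambda>t. F (x + t *\<^sub>R axis j 1)) 0"

(* Intended for open S, where the iterated two-sided derivatives at points of S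
   depend only on the values of f on S. *)
definition smooth_real_on :: "(real \<Rightarrow> real) \<Rightarrow> real set \<Rightarrow> bool" where
  "smooth_real_on f S \<longleftrightarrow> (\<forall>n. \<forall>t\<in>S. (deriv ^^ n) f differentiable (at t))"

definition eta :: "real ^ 3 \<Rightarrow> real ^ 3 \<Rightarrow> real ^ 3 \<Rightarrow> real" where
  "eta a b x = (a $ 1 * x $ 1 + a $ 2 * x $ 2 + a $ 3 * x $ 3) /
               (b $ 1 * x $ 1 + b $ 2 * x $ 2 + b $ 3 * x $ 3)"

definition guichard_sign :: "3 \<Rightarrow> real" where
  "guichard_sign i = (if i = 2 then - 1 else 1)"

definition lame_h :: "(3 \<Rightarrow> real ^ 3 \<Rightarrow> real) \<Rightarrow> 3 \<Rightarrow> 3 \<Rightarrow> real ^ 3 \<Rightarrow> real" where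
  "lame_h L i j x = partial_deriv j (L i) x / L j x"

definition lame_guichard_on :: "(3 \<Rightarrow> real ^ 3 \<Rightarrow> real) \<Rightarrow> (real ^ 3) set \<Rightarrow> bool" where
  "lame_guichard_on L U \<longleftrightarrow>
     (let \<epsilon> = guichard_sign; h = lame_h L in
      \<forall>x\<in>U. \<forall>i j k. i \<noteq> j \<and> j \<noteq> k \<and> i \<noteq> k \<longrightarrow>
        \<epsilon> i * (L i x)\<^sup>2 + \<epsilon> j * (L j x)\<^sup>2 + \<epsilon> k * (L k x)\<^sup>2 = 0 \<and>
        \<epsilon> i * partial_deriv i (L i) x + \<epsilon> j * h j i x * L j x + \<epsilon> k * h k i x * L k x = 0 \<and>
        partial_deriv k (h i j) x - h i k x * h k j x = 0 \<and>
        partial_deriv j (h i j) x + partial_deriv i (h j i) x + h i k x * h j k x = 0 \<and>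
        \<epsilon> i * partial_deriv i (h i j) x + \<epsilon> j * partial_deriv j (h j i) x
          + \<epsilon> k * h k i x * h k j x = 0)"

end

theory Submission
  imports Defs
begin

text \<open>Along \<open>\<eta>\<close> the system becomes a system of ordinary differential equations. If
  \<open>(a\<^sub>i, b\<^sub>i) = (0, 0)\<close>, the equations containing \<open>h\<^sub>i\<^sub>j\<close> and \<open>h\<^sub>i\<^sub>k\<close> are algebraically inconsistent
  unless \<open>l\<^sub>i' = 0\<close>. The Guichard condition then parametrizes \<open>(l\<^sub>j, l\<^sub>k)\<close> by a hyperbolic or
  circular angle \<open>\<phi>\<close> with \<open>\<phi>' = l\<^sub>k' / l\<^sub>j\<close>, and the one remaining equation says that \<open>\<phi>'\<close> times
  \<open>(a\<^sub>j - b\<^sub>j \<eta>)\<^sup>2 \<plusminus> (a\<^sub>k - b\<^sub>k \<eta>)\<^sup>2\<close> is constant. Integrating gives an arctangent for the sign \<open>+\<close> and a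
  logarithm for the sign \<open>-\<close>.\<close>

section \<open>Preliminaries on indices, logarithms and antiderivatives\<close>

lemma UNIV_3_distinct:
  fixes i j k :: 3
  assumes "i \<noteq> j" "j \<noteq> k" "i \<noteq> k"
  shows "n = i \<or> n = j \<or> n = k"
  using assms exhaust_3[of i] exhaust_3[of j] exhaust_3[of k] exhaust_3[of n] by metis

lemma eta_eq_inner: "eta a b x = (a \<bullet> x) / (b \<bullet> x)"
  by (simp add: eta_def inner_vec_def sum_3)

text \<open>Near a nonzero point the absolute value is the identity or the negation, so the rule for
  \<open>ln\<close> covers both signs. The logarithmic solutions are differentiated with it.\<close>

lemma DERIV_ln_abs:
  assumes "x \<noteq> (0::real)"
  shows "((\<lambda>x. ln \<bar>x\<bar>) has_real_derivative 1 / x) (at x)"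
proof (cases "x > 0")
  case True
  then have "eventually (\<lambda>y. y \<in> {0<..}) (nhds x)" by (intro eventually_nhds_in_open) auto
  then have "eventually (\<lambda>y. ln \<bar>y\<bar> = ln y) (nhds x)" by eventually_elim simp
  from DERIV_cong_ev[OF refl this refl] show ?thesis using DERIV_ln_divide[OF True] by blast
next
  case False
  then have "x < 0" using assms by simp
  then have "eventually (\<lambda>y. y \<in> {..<0}) (nhds x)" by (intro eventually_nhds_in_open) auto
  then have "eventually (\<lambda>y. ln \<bar>y\<bar> = ln (- y)) (nhds x)" by eventually_elim simp
  moreover have "((\<lambda>y. ln (- y)) has_real_derivative 1 / x) (at x)"
    using \<open>x < 0\<close> by (auto intro!: derivative_eq_intros)
  ultimately show ?thesis
    using DERIV_cong_ev[OF refl _ refl, of "\<lambda>y. ln \<bar>y\<bar>" "\<lambda>y. ln (- y)"] by blast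
qed

lemma constant_on_interval:
  fixes f :: "real \<Rightarrow> real"
  assumes "is_interval I" "\<And>t. t \<in> I \<Longrightarrow> (f has_real_derivative 0) (at t)"
  obtains c where "\<And>t. t \<in> I \<Longrightarrow> f t = c"
proof -
  have "convex I" using assms(1) is_interval_convex by blast
  then have "\<exists>c. \<forall>t\<in>I. f t = c"
    using has_field_derivative_zero_constant[of I f] assms(2)
    by (auto intro: has_field_derivative_at_within)
  then show thesis using that by blast
qed

lemma equal_derivatives_on_interval:
  fixes f g f' :: "real \<Rightarrow> real"
  assumes "is_interval I"
    and "\<And>t. t \<in> I \<Longrightarrow> (f has_real_derivative f' t) (at t)"
    and "\<And>t. t \<in> I \<Longrightarrow> (g has_real_derivative f' t) (at t)"
  obtains c where "\<And>t. t \<in> I \<Longrightarrow> f t = g t + c"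
proof -
  have "((\<lambda>t. f t - g t) has_real_derivative 0) (at t)" if "t \<in> I" for t
    using DERIV_diff[OF assms(2)[OF that] assms(3)[OF that]] by simp
  from constant_on_interval[OF assms(1) this] obtain c where "\<And>t. t \<in> I \<Longrightarrow> f t - g t = c"
    by metis
  then have "f t = g t + c" if "t \<in> I" for t using that by force
  then show thesis using that by blast
qed

section \<open>Reduction of the system to ordinary differential equations in \<eta>\<close>

text \<open>\<open>{a, b}\<close> is a set, so its independence alone would admit
  \<open>a = b\<close>; \<open>a_neq_b\<close> excludes that. As \<open>image_I\<close> is an
  equality, each \<open>t\<close> in \<open>I\<close> is reached from some point of
  \<open>U\<close>, and the equations on \<open>U\<close> yield equations at every
  \<open>t\<close>.\<close>

locale lame_solution =
  fixes a b :: "real ^ 3" and l :: "3 \<Rightarrow> real \<Rightarrow> real"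
    and U :: "(real ^ 3) set" and I :: "real set"
  assumes a_neq_b: "a \<noteq> b" and indep: "independent {a, b}"
    and open_U: "open U" and denominator: "x \<in> U \<Longrightarrow> b \<bullet> x \<noteq> 0"
    and open_I: "open I" and interval_I: "is_interval I" and image_I: "eta a b ` U = I"
    and smooth: "smooth_real_on (l i) I" and pos: "t \<in> I \<Longrightarrow> l i t > 0"
    and lame: "lame_guichard_on (\<lambda>i x. l i (eta a b x)) U"
begin

text \<open>With \<open>D = b \<bullet> x\<close>, one has \<open>\<partial>\<eta>/\<partial>x\<^sub>j = p j \<eta> / D\<close> and \<open>h\<^sub>i\<^sub>j = w i j \<eta> * p j \<eta> / D\<close>.\<close>

definition p :: "3 \<Rightarrow> real \<Rightarrow> real" where "p j t = a $ j - b $ j * t"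

definition w :: "3 \<Rightarrow> 3 \<Rightarrow> real \<Rightarrow> real" where "w i j t = deriv (l i) t / l j t"

lemma l_has_deriv: "t \<in> I \<Longrightarrow> (l i has_real_derivative deriv (l i) t) (at t)"
  using smooth[of i] unfolding smooth_real_on_def
  by (metis DERIV_deriv_iff_real_differentiable funpow_0)

lemma deriv_l_has_deriv: "t \<in> I \<Longrightarrow> (deriv (l i) has_real_derivative deriv (deriv (l i)) t) (at t)"
proof -
  assume "t \<in> I"
  then have "(deriv ^^ 1) (l i) differentiable (at t)"
    using smooth[of i] unfolding smooth_real_on_def by blast
  then show ?thesis by (simp add: DERIV_deriv_iff_real_differentiable)
qed

lemma w_has_deriv: "t \<in> I \<Longrightarrow> (w i j has_real_derivative deriv (w i j) t) (at t)"
proof -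
  assume t: "t \<in> I"
  have "((\<lambda>t. deriv (l i) t / l j t) has_real_derivative
      (deriv (deriv (l i)) t * l j t - deriv (l i) t * deriv (l j) t) / (l j t * l j t)) (at t)"
    using pos[OF t, of j] by (intro DERIV_divide deriv_l_has_deriv l_has_deriv t) auto
  then have "(w i j has_real_derivative
      (deriv (deriv (l i)) t * l j t - deriv (l i) t * deriv (l j) t) / (l j t * l j t)) (at t)"
    unfolding w_def[abs_def] .
  then show ?thesis using DERIV_imp_deriv by metis
qed

lemma inner_line_has_deriv:
  "((\<lambda>t. v \<bullet> (x + t *\<^sub>R axis j 1)) has_real_derivative v $ j) (at t)" for v x :: "real ^ 3"
  unfolding inner_add_right inner_scaleR_right
  by (auto intro!: derivative_eq_intros simp: inner_axis)

lemma eta_line_has_deriv: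
  assumes "x \<in> U"
  shows "((\<lambda>t. eta a b (x + t *\<^sub>R axis j 1)) has_real_derivative
          p j (eta a b x) / (b \<bullet> x)) (at 0)"
proof -
  note D = denominator[OF assms]
  have "((\<lambda>t. (a \<bullet> (x + t *\<^sub>R axis j 1)) / (b \<bullet> (x + t *\<^sub>R axis j 1))) has_real_derivative
     (a $ j * (b \<bullet> (x + 0 *\<^sub>R axis j 1)) - (a \<bullet> (x + 0 *\<^sub>R axis j 1)) * b $ j) /
     ((b \<bullet> (x + 0 *\<^sub>R axis j 1)) * (b \<bullet> (x + 0 *\<^sub>R axis j 1)))) (at 0)"
    using D by (intro DERIV_divide inner_line_has_deriv) auto
  moreover have "(a $ j * (b \<bullet> (x + 0 *\<^sub>R axis j 1)) - (a \<bullet> (x + 0 *\<^sub>R axis j 1)) * b $ j) /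
     ((b \<bullet> (x + 0 *\<^sub>R axis j 1)) * (b \<bullet> (x + 0 *\<^sub>R axis j 1))) = p j (eta a b x) / (b \<bullet> x)"
    using D by (simp add: p_def eta_eq_inner field_simps)
  ultimately show ?thesis unfolding eta_eq_inner by simp
qed

lemma eta_in_I: "x \<in> U \<Longrightarrow> eta a b x \<in> I"
  using image_I by blast

lemma compose_eta_has_deriv:
  assumes "x \<in> U" "(f has_real_derivative d) (at (eta a b x))"
  shows "((\<lambda>t. f (eta a b (x + t *\<^sub>R axis j 1))) has_real_derivative
          d * (p j (eta a b x) / (b \<bullet> x))) (at 0)"
  by (rule DERIV_chain2[OF _ eta_line_has_deriv[OF assms(1)]]) (use assms(2) in simp)

lemma lame_h_eq:
  assumes "x \<in> U"
  shows "lame_h (\<lambda>i x. l i (eta a b x)) i j x = w i j (eta a b x) * p j (eta a b x) / (b \<bullet> x)"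
proof -
  have "partial_deriv j (\<lambda>x. l i (eta a b x)) x
      = deriv (l i) (eta a b x) * (p j (eta a b x) / (b \<bullet> x))"
    unfolding partial_deriv_def
    by (rule DERIV_imp_deriv[OF compose_eta_has_deriv[OF assms l_has_deriv[OF eta_in_I[OF assms]]]])
  then show ?thesis unfolding lame_h_def by (simp add: w_def)
qed

text \<open>Each part of \<open>w i j * p j / D\<close> contributes: \<open>w i j\<close> its
  derivative, \<open>p j\<close> the term with \<open>b $ j\<close>, and the denominator
  \<open>D\<close> the term with \<open>b $ k\<close>. The common factor is
  \<open>1 / D\<^sup>2\<close>.\<close>

lemma partial_deriv_lame_h:
  assumes x: "x \<in> U"
  defines "t \<equiv> eta a b x"
  shows "partial_deriv k (lame_h (\<lambda>i x. l i (eta a b x)) i j) x =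
    (deriv (w i j) t * p j t * p k t - w i j t * (b $ j * p k t + b $ k * p j t)) / (b \<bullet> x)\<^sup>2"
proof -
  let ?y = "\<lambda>s. x + s *\<^sub>R axis k (1::real)"
  note D = denominator[OF x]
  have tI: "t \<in> I" using eta_in_I[OF x] t_def by simp
  have wd: "((\<lambda>s. w i j (eta a b (?y s))) has_real_derivative deriv (w i j) t * (p k t / (b \<bullet> x))) (at 0)"
    unfolding t_def by (intro compose_eta_has_deriv x w_has_deriv eta_in_I)
  have "(p j has_real_derivative - b $ j) (at (eta a b x))"
    unfolding p_def[abs_def] by (auto intro!: derivative_eq_intros)
  then have pd: "((\<lambda>s. p j (eta a b (?y s))) has_real_derivative - b $ j * (p k t / (b \<bullet> x))) (at 0)"
    unfolding t_def by (intro compose_eta_has_deriv x)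
  let ?d = "(deriv (w i j) t * p j t * p k t - w i j t * (b $ j * p k t + b $ k * p j t)) / (b \<bullet> x)\<^sup>2"
  have "((\<lambda>s. w i j (eta a b (?y s)) * p j (eta a b (?y s)) / (b \<bullet> ?y s)) has_real_derivative
      ((deriv (w i j) t * (p k t / (b \<bullet> x)) * p j (eta a b (?y 0)) +
        - b $ j * (p k t / (b \<bullet> x)) * w i j (eta a b (?y 0))) * (b \<bullet> ?y 0)
       - w i j (eta a b (?y 0)) * p j (eta a b (?y 0)) * b $ k) / ((b \<bullet> ?y 0) * (b \<bullet> ?y 0))) (at 0)"
    using D by (intro DERIV_divide DERIV_mult wd pd inner_line_has_deriv) auto
  also have "((deriv (w i j) t * (p k t / (b \<bullet> x)) * p j (eta a b (?y 0)) +
        - b $ j * (p k t / (b \<bullet> x)) * w i j (eta a b (?y 0))) * (b \<bullet> ?y 0)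
       - w i j (eta a b (?y 0)) * p j (eta a b (?y 0)) * b $ k) / ((b \<bullet> ?y 0) * (b \<bullet> ?y 0)) = ?d"
    using D by (simp add: t_def[symmetric] power2_eq_square field_simps)
  finally have *: "((\<lambda>s. w i j (eta a b (?y s)) * p j (eta a b (?y s)) / (b \<bullet> ?y s))
      has_real_derivative ?d) (at 0)" .
  \<comment> \<open>The derivative of \<open>lame_h\<close> requires its closed form near the base
    point, not just at it; openness of \<open>U\<close> keeps short segments of the line inside
    \<open>U\<close>.\<close>
  have "((\<lambda>s. ?y s) \<longlongrightarrow> x + 0 *\<^sub>R axis k 1) (nhds 0)"
    by (intro tendsto_intros) (simp add: filterlim_ident)
  then have "eventually (\<lambda>s. ?y s \<in> U) (nhds 0)"
    using open_U x by (auto simp: tendsto_def)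
  then have "eventually (\<lambda>s. w i j (eta a b (?y s)) * p j (eta a b (?y s)) / (b \<bullet> ?y s)
      = lame_h (\<lambda>i x. l i (eta a b x)) i j (?y s)) (nhds 0)"
    by eventually_elim (simp add: lame_h_eq)
  from DERIV_cong_ev[OF refl this refl] * show ?thesis
    unfolding partial_deriv_def using DERIV_imp_deriv by blast
qed

text \<open>Both equations in \<open>h\<close> treated here are homogeneous in
  \<open>1 / D\<^sup>2\<close>. Cancelling this factor leaves a dependence on \<open>x\<close>
  through \<open>t\<close> alone.\<close>

lemma lame_ode:
  assumes t: "t \<in> I" and ijk: "i \<noteq> j" "j \<noteq> k" "i \<noteq> k"
  shows guichard: "guichard_sign i * (l i t)\<^sup>2 + guichard_sign j * (l j t)\<^sup>2
      + guichard_sign k * (l k t)\<^sup>2 = 0"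
    and lame_mixed: "deriv (w i j) t * p j t * p k t - w i j t * (b $ j * p k t + b $ k * p j t)
      = w i k t * p k t * (w k j t * p j t)"
    and lame_sum: "deriv (w i j) t * (p j t)\<^sup>2 - 2 * w i j t * b $ j * p j t
      + (deriv (w j i) t * (p i t)\<^sup>2 - 2 * w j i t * b $ i * p i t)
      + w i k t * p k t * (w j k t * p k t) = 0"
proof -
  obtain x where x: "x \<in> U" "t = eta a b x" using t image_I by blast
  note D = denominator[OF x(1)]
  note lame' = lame[unfolded lame_guichard_on_def Let_def, rule_format, OF x(1), of i j k, simplified ijk]
  show "guichard_sign i * (l i t)\<^sup>2 + guichard_sign j * (l j t)\<^sup>2
      + guichard_sign k * (l k t)\<^sup>2 = 0"
    using lame' x(2) by simp
  have "(deriv (w i j) t * p j t * p k t - w i j t * (b $ j * p k t + b $ k * p j t)) / (b \<bullet> x)\<^sup>2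
      - w i k t * p k t / (b \<bullet> x) * (w k j t * p j t / (b \<bullet> x)) = 0"
    using lame' by (simp add: partial_deriv_lame_h[OF x(1)] lame_h_eq[OF x(1)] x(2))
  then have "(deriv (w i j) t * p j t * p k t - w i j t * (b $ j * p k t + b $ k * p j t)
      - w i k t * p k t * (w k j t * p j t)) / (b \<bullet> x)\<^sup>2 = 0"
    by (simp add: diff_divide_distrib power2_eq_square)
  then show "deriv (w i j) t * p j t * p k t - w i j t * (b $ j * p k t + b $ k * p j t)
      = w i k t * p k t * (w k j t * p j t)"
    using D by simp
  have "(deriv (w i j) t * p j t * p j t - w i j t * (b $ j * p j t + b $ j * p j t)) / (b \<bullet> x)\<^sup>2
      + (deriv (w j i) t * p i t * p i t - w j i t * (b $ i * p i t + b $ i * p i t)) / (b \<bullet> x)\<^sup>2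
      + w i k t * p k t / (b \<bullet> x) * (w j k t * p k t / (b \<bullet> x)) = 0"
    using lame' by (simp add: partial_deriv_lame_h[OF x(1)] lame_h_eq[OF x(1)] x(2))
  then have "(deriv (w i j) t * p j t * p j t - w i j t * (b $ j * p j t + b $ j * p j t)
      + (deriv (w j i) t * p i t * p i t - w j i t * (b $ i * p i t + b $ i * p i t))
      + w i k t * p k t * (w j k t * p k t)) / (b \<bullet> x)\<^sup>2 = 0"
    by (simp add: add_divide_distrib power2_eq_square)
  then show "deriv (w i j) t * (p j t)\<^sup>2 - 2 * w i j t * b $ j * p j t
      + (deriv (w j i) t * (p i t)\<^sup>2 - 2 * w j i t * b $ i * p i t)
      + w i k t * p k t * (w j k t * p k t) = 0"
    using D by (simp add: power2_eq_square algebra_simps)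
qed

end

section \<open>Consequences of one vanishing pair\<close>

locale degenerate_lame_solution = lame_solution +
  fixes i j k :: 3
  assumes ijk: "i \<noteq> j" "j \<noteq> k" "i \<noteq> k" and ab0: "a $ i = 0" "b $ i = 0"
begin

text \<open>With the components at \<open>i\<close> zero, this is up to sign the only minor of
  \<open>a\<close>, \<open>b\<close> that can be nonzero, so it carries their independence.\<close>

definition \<Delta> :: real where "\<Delta> = a $ j * b $ k - a $ k * b $ j"

lemma b_nonzero: "b $ j \<noteq> 0 \<or> b $ k \<noteq> 0"
proof (rule ccontr)
  assume "\<not> ?thesis"
  then have "b $ n = 0" for n using ab0 UNIV_3_distinct[OF ijk, of n] by auto
  then have "b = 0" by (simp add: vec_eq_iff)
  then show False using indep dependent_zero[of "{a, b}"] by auto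
qed

text \<open>A vanishing minor would make \<open>a\<close> a multiple of \<open>b\<close>; the factor
  is read off at a component \<open>m\<close> where \<open>b\<close> does not vanish.\<close>

lemma Delta_nonzero: "\<Delta> \<noteq> 0"
proof
  assume 0: "\<Delta> = 0"
  obtain m where m: "b $ m \<noteq> 0" "m = j \<or> m = k" using b_nonzero by blast
  have "a $ n = (a $ m / b $ m) * b $ n" for n
    using 0 m ab0 UNIV_3_distinct[OF ijk, of n] by (auto simp: \<Delta>_def field_simps)
  then have "a = (a $ m / b $ m) *\<^sub>R b"
    unfolding vec_eq_iff vector_scaleR_component real_scaleR_def by blast
  then have "a \<in> span {b}" by (metis insertI1 span_base span_scale)
  then show False using indep a_neq_b by (simp add: independent_insert)
qed

lemma p_Delta: "b $ k * p j t - b $ j * p k t = \<Delta>"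
  by (simp add: p_def \<Delta>_def algebra_simps)

text \<open>By \<open>p_Delta\<close>, a common zero of \<open>p j\<close> and \<open>p k\<close>
  would force \<open>\<Delta> = 0\<close>.\<close>

lemma p_square_sum_pos: "(p j t)\<^sup>2 + (p k t)\<^sup>2 > 0"
proof -
  have "p j t \<noteq> 0 \<or> p k t \<noteq> 0" using p_Delta[of t] Delta_nonzero by auto
  then show ?thesis by (simp add: sum_power2_gt_zero_iff)
qed

text \<open>Eliminating the second derivatives leaves a homogeneous linear system for
  \<open>w i j * p j\<close> and \<open>w i k * p k\<close> with determinant \<open>\<Delta>\<^sup>2 + X\<^sup>2\<close>.\<close>

lemma deriv_l_degenerate: assumes t: "t \<in> I" shows "deriv (l i) t = 0"
proof -
  have pi: "p i t = 0" using ab0 by (simp add: p_def)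
  define X where "X = (p j t)\<^sup>2 * w k j t + (p k t)\<^sup>2 * w j k t"
  define A where "A = w i j t * p j t"
  define B where "B = w i k t * p k t"
  have e1: "deriv (w i j) t * (p j t)\<^sup>2 - 2 * w i j t * b $ j * p j t + B * (w j k t * p k t) = 0"
    using lame_sum[OF t ijk] pi by (simp add: B_def)
  have e2: "deriv (w i k) t * (p k t)\<^sup>2 - 2 * w i k t * b $ k * p k t + A * (w k j t * p j t) = 0"
    using lame_sum[OF t ijk(3) ijk(2)[symmetric] ijk(1)] pi by (simp add: A_def)
  have e3: "deriv (w i j) t * p j t * p k t - w i j t * (b $ j * p k t + b $ k * p j t)
      = B * (w k j t * p j t)"
    using lame_mixed[OF t ijk] by (simp add: B_def)
  have e4: "deriv (w i k) t * p k t * p j t - w i k t * (b $ k * p j t + b $ j * p k t)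
      = A * (w j k t * p k t)"
    using lame_mixed[OF t ijk(3) ijk(2)[symmetric] ijk(1)] by (simp add: A_def)
  \<comment> \<open>\<open>e1\<close> times \<open>p k t\<close> minus \<open>e3\<close> times
    \<open>p j t\<close> cancels \<open>deriv (w i j) t\<close>; the terms in \<open>b\<close>
    combine to \<Delta> by \<open>p_Delta\<close>. \<open>f2\<close> arises likewise from
    \<open>e2\<close> and \<open>e4\<close>.\<close>
  have f1: "A * \<Delta> + B * X = 0"
    using e1 e3 unfolding p_Delta[of t, symmetric] A_def B_def X_def by algebra
  have f2: "A * X - B * \<Delta> = 0"
    using e2 e4 unfolding p_Delta[of t, symmetric] A_def B_def X_def by algebra
  have "A * (\<Delta>\<^sup>2 + X\<^sup>2) = 0" "B * (\<Delta>\<^sup>2 + X\<^sup>2) = 0" using f1 f2 by algebra+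
  moreover have "\<Delta>\<^sup>2 + X\<^sup>2 \<noteq> 0" using Delta_nonzero by (simp add: sum_power2_eq_zero_iff)
  ultimately have "A = 0" "B = 0" by auto
  \<comment> \<open>One of \<open>p j t\<close>, \<open>p k t\<close> is nonzero, so
    \<open>w i j t\<close> or \<open>w i k t\<close> vanishes; each is \<open>deriv (l i) t\<close>
    over a positive number.\<close>
  then show ?thesis
    using p_square_sum_pos[of t] pos[OF t, of j] pos[OF t, of k]
    by (auto simp: A_def B_def w_def)
qed

lemma l_degenerate_constant: obtains lam where "lam > 0" "\<And>t. t \<in> I \<Longrightarrow> l i t = lam"
proof -
  obtain c where c: "\<And>t. t \<in> I \<Longrightarrow> l i t = c"
    using constant_on_interval[OF interval_I, of "l i"] l_has_deriv deriv_l_degenerate by metis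
  show thesis
  \<comment> \<open>On an empty \<open>I\<close> the constant \<open>c\<close> is arbitrary and need
    not be positive, so 1 is supplied instead.\<close>
  proof (cases "I = {}")
    case True
    then show thesis using that[of 1] by simp
  next
    case False
    then obtain t where "t \<in> I" by blast
    then have "c > 0" using c[of t] pos[of t i] by simp
    then show thesis using that c by blast
  qed
qed

text \<open>This is the Guichard condition differentiated on the open set \<open>I\<close>, with the
  term of \<open>l i\<close> gone, and divided by \<open>2 * l j t * l k t\<close>.\<close>

lemma w_relation: assumes t: "t \<in> I" shows "guichard_sign j * w j k t + guichard_sign k * w k j t = 0"
proof -
  let ?F = "\<lambda>t. guichard_sign i * (l i t)\<^sup>2 + guichard_sign j * (l j t)\<^sup>2 + guichard_sign k * (l k t)\<^sup>2"
  have "eventually (\<lambda>s. s \<in> I) (nhds t)" using open_I t eventually_nhds by blast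
  then have "eventually (\<lambda>s. ?F s = 0) (nhds t)"
    by eventually_elim (use guichard[OF _ ijk] in simp)
  then have "(?F has_real_derivative 0) (at t)"
    using DERIV_cong_ev[OF refl, of ?F "\<lambda>_. 0" t 0 0] by simp
  moreover have "(?F has_real_derivative 2 * (guichard_sign j * l j t * deriv (l j) t
      + guichard_sign k * l k t * deriv (l k) t)) (at t)"
    using deriv_l_degenerate[OF t]
    by (auto intro!: derivative_eq_intros l_has_deriv[OF t] simp: algebra_simps)
  ultimately have "guichard_sign j * l j t * deriv (l j) t + guichard_sign k * l k t * deriv (l k) t = 0"
    using DERIV_unique by fastforce
  moreover have "guichard_sign j * w j k t + guichard_sign k * w k j t =
     (guichard_sign j * l j t * deriv (l j) t + guichard_sign k * l k t * deriv (l k) t) / (l j t * l k t)"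
    using pos[OF t, of j] pos[OF t, of k] by (simp add: w_def field_simps)
  ultimately show ?thesis by simp
qed

text \<open>\<open>s\<close> is \<open>1\<close> in the hyperbolic cases and \<open>-1\<close> in the trigonometric case.\<close>

lemma first_integral:
  assumes s: "s = - guichard_sign j * guichard_sign k"
  obtains K where "\<And>t. t \<in> I \<Longrightarrow> w k j t * ((p j t)\<^sup>2 + s * (p k t)\<^sup>2) = K"
proof -
  have ss: "guichard_sign j * guichard_sign j = 1" by (simp add: guichard_sign_def)
  have wjk: "w j k t = s * w k j t" if "t \<in> I" for t
    using w_relation[OF that] ss unfolding s by algebra
  have "((\<lambda>t. w k j t * ((p j t)\<^sup>2 + s * (p k t)\<^sup>2)) has_real_derivative 0) (at t)"
    if t: "t \<in> I" for t
  proof -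
    have "eventually (\<lambda>u. u \<in> I) (nhds t)" using open_I t eventually_nhds by blast
    then have "eventually (\<lambda>u. w j k u = s * w k j u) (nhds t)"
      by eventually_elim (rule wjk)
    moreover have "((\<lambda>u. s * w k j u) has_real_derivative s * deriv (w k j) t) (at t)"
      by (intro DERIV_cmult w_has_deriv t)
    ultimately have "(w j k has_real_derivative s * deriv (w k j) t) (at t)"
      using DERIV_cong_ev[OF refl, of "w j k" "\<lambda>u. s * w k j u" t] by simp
    then have dw: "deriv (w j k) t = s * deriv (w k j) t" by (rule DERIV_imp_deriv)
    have wi: "w j i t * p i t = 0" "w k i t * p i t = 0" using ab0 by (simp_all add: p_def)
    \<comment> \<open>With the product term killed by \<open>p i t = 0\<close>, the equation is
      exactly the vanishing of the derivative of the claimed integral.\<close>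
    have "s * deriv (w k j) t * (p k t)\<^sup>2 - 2 * (s * w k j t) * b $ k * p k t
      + (deriv (w k j) t * (p j t)\<^sup>2 - 2 * w k j t * b $ j * p j t) = 0"
      using lame_sum[OF t ijk(2) ijk(3)[symmetric] ijk(1)[symmetric]] wi dw wjk[OF t] by simp
    moreover have "(p n has_real_derivative - b $ n) (at t)" for n
      unfolding p_def[abs_def] by (auto intro!: derivative_eq_intros)
    then have "((\<lambda>t. w k j t * ((p j t)\<^sup>2 + s * (p k t)\<^sup>2)) has_real_derivative
       deriv (w k j) t * ((p j t)\<^sup>2 + s * (p k t)\<^sup>2)
       + w k j t * (2 * p j t * - b $ j + s * (2 * p k t * - b $ k))) (at t)"
      by (auto intro!: derivative_eq_intros w_has_deriv[OF t])
    ultimately show ?thesis by (simp add: algebra_simps)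
  qed
  from constant_on_interval[OF interval_I this] show thesis using that by metis
qed

section \<open>Explicit integration: arctangent and logarithm\<close>

text \<open>Here the Guichard condition reads
  \<open>(l j)\<^sup>2 = lam\<^sup>2 + (l k)\<^sup>2\<close>, so \<open>arsinh (l k / lam)\<close>
  serves as the angle. Its derivative is \<open>w k j\<close>, which the first integral
  \<open>K\<close> makes the reciprocal of a positive quadratic; \<open>C\<close> is
  \<open>K\<close>.\<close>

lemma hyperbolic_case:
  assumes gs: "guichard_sign i = 1" "guichard_sign j = -1" "guichard_sign k = 1"
  obtains lam \<phi> C c where
    "\<And>t. t \<in> I \<Longrightarrow> l i t = lam \<and> l j t = lam * cosh (\<phi> t) \<and> l k t = lam * sinh (\<phi> t)"
    "\<And>t. t \<in> I \<Longrightarrow> \<phi> t = C / \<Delta> * arctan (((b $ j)\<^sup>2 + (b $ k)\<^sup>2) / \<Delta> *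
       (t - (a $ j * b $ j + a $ k * b $ k) / ((b $ j)\<^sup>2 + (b $ k)\<^sup>2))) + c"
proof -
  obtain lam where lam: "lam > 0" "\<And>t. t \<in> I \<Longrightarrow> l i t = lam" using l_degenerate_constant by blast
  define \<phi> where "\<phi> = (\<lambda>t. arsinh (l k t / lam))"
  have sq: "sqrt ((l k t / lam)\<^sup>2 + 1) = l j t / lam" if "t \<in> I" for t
  proof -
    have "(l k t / lam)\<^sup>2 + 1 = (l j t / lam)\<^sup>2"
      using guichard[OF that ijk] lam(1) lam(2)[OF that] by (simp add: gs field_simps)
    then show ?thesis using lam(1) pos[OF that, of j] by simp
  qed
  have A: "l i t = lam \<and> l j t = lam * cosh (\<phi> t) \<and> l k t = lam * sinh (\<phi> t)" if "t \<in> I" for t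
    using sq[OF that] lam(1) lam(2)[OF that] by (simp add: \<phi>_def cosh_arsinh_real)
  obtain K where K: "\<And>t. t \<in> I \<Longrightarrow> w k j t * ((p j t)\<^sup>2 + 1 * (p k t)\<^sup>2) = K"
    using first_integral[of 1] gs by auto
  define \<beta> where "\<beta> = (b $ j)\<^sup>2 + (b $ k)\<^sup>2"
  define \<gamma> where "\<gamma> = a $ j * b $ j + a $ k * b $ k"
  have \<beta>: "\<beta> > 0" using b_nonzero by (simp add: \<beta>_def sum_power2_gt_zero_iff)
  have d\<phi>: "(\<phi> has_real_derivative K / ((p j t)\<^sup>2 + (p k t)\<^sup>2)) (at t)" if t: "t \<in> I" for t
  proof -
    have "(\<phi> has_real_derivative 1 / sqrt ((l k t / lam)\<^sup>2 + 1) * (deriv (l k) t / lam)) (at t)"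
      unfolding \<phi>_def
      by (rule DERIV_chain2[OF arsinh_real_has_field_derivative[THEN DERIV_cong]])
         (auto intro!: DERIV_cdivide l_has_deriv t)
    moreover have "1 / sqrt ((l k t / lam)\<^sup>2 + 1) * (deriv (l k) t / lam) = w k j t"
      unfolding sq[OF t] using lam(1) by (simp add: w_def)
    moreover have "w k j t = K / ((p j t)\<^sup>2 + (p k t)\<^sup>2)"
      using K[OF t] less_imp_neq[OF p_square_sum_pos[of t]] by (metis eq_divide_imp mult_1)
    ultimately show ?thesis by simp
  qed
  have darctan: "((\<lambda>t. K / \<Delta> * arctan (\<beta> / \<Delta> * (t - \<gamma> / \<beta>))) has_real_derivative
      K / ((p j t)\<^sup>2 + (p k t)\<^sup>2)) (at t)" for t
  proof -
    let ?y = "\<beta> / \<Delta> * (t - \<gamma> / \<beta>)"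
    have "((\<lambda>t. K / \<Delta> * arctan (\<beta> / \<Delta> * (t - \<gamma> / \<beta>))) has_real_derivative
        K / \<Delta> * (inverse (1 + ?y\<^sup>2) * (\<beta> / \<Delta>))) (at t)"
      using Delta_nonzero by (auto intro!: derivative_eq_intros)
    moreover have "K / \<Delta> * (inverse (1 + ?y\<^sup>2) * (\<beta> / \<Delta>)) = K / ((p j t)\<^sup>2 + (p k t)\<^sup>2)"
    proof -
      have y: "?y = (\<beta> * t - \<gamma>) / \<Delta>"
        using \<beta> by (simp add: right_diff_distrib diff_divide_distrib)
      have "\<Delta>\<^sup>2 * (1 + ?y\<^sup>2) = \<Delta>\<^sup>2 + (\<beta> * t - \<gamma>)\<^sup>2"
        unfolding y using Delta_nonzero by (simp add: field_simps)
      \<comment> \<open>Completing the square in \<open>t\<close>; the constant terms agree by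
        Lagrange's identity for the components \<open>j\<close> and \<open>k\<close>.\<close>
      also have "\<dots> = \<beta> * ((p j t)\<^sup>2 + (p k t)\<^sup>2)"
        unfolding \<Delta>_def \<beta>_def \<gamma>_def p_def by algebra
      finally have *: "\<Delta>\<^sup>2 * (1 + ?y\<^sup>2) = \<beta> * ((p j t)\<^sup>2 + (p k t)\<^sup>2)" .
      have "K / \<Delta> * (inverse (1 + ?y\<^sup>2) * (\<beta> / \<Delta>)) = K * \<beta> / (\<Delta>\<^sup>2 * (1 + ?y\<^sup>2))"
        by (simp add: divide_inverse power2_eq_square)
      also have "\<dots> = K / ((p j t)\<^sup>2 + (p k t)\<^sup>2)" unfolding * using \<beta> by simp
      finally show ?thesis .
    qed
    ultimately show ?thesis by simp
  qed
  obtain c where "\<And>t. t \<in> I \<Longrightarrow> \<phi> t = K / \<Delta> * arctan (\<beta> / \<Delta> * (t - \<gamma> / \<beta>)) + c"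
    using equal_derivatives_on_interval[OF interval_I d\<phi> darctan] by metis
  then show thesis using that[OF A, of K c] unfolding \<beta>_def \<gamma>_def by blast
qed

text \<open>If the quadratic \<open>(p j)\<^sup>2 - (p k)\<^sup>2\<close> has a zero in \<open>I\<close>, then \<open>K = 0\<close>; its zeros being finitely
  many, \<open>\<phi>\<close> is then constant.\<close>

lemma trigonometric_case:
  assumes gs: "guichard_sign i = -1" "guichard_sign j = 1" "guichard_sign k = 1"
  obtains lam \<phi> K where
    "\<And>t. t \<in> I \<Longrightarrow> l i t = lam \<and> l j t = lam * cos (\<phi> t) \<and> l k t = lam * sin (\<phi> t)"
    "(\<exists>c. \<forall>t\<in>I. \<phi> t = c) \<or>
     (\<forall>t\<in>I. p j t - p k t \<noteq> 0 \<and> p j t + p k t \<noteq> 0 \<and>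
        (\<phi> has_real_derivative K / ((p j t - p k t) * (p j t + p k t))) (at t))"
proof -
  obtain lam where lam: "lam > 0" "\<And>t. t \<in> I \<Longrightarrow> l i t = lam" using l_degenerate_constant by blast
  \<comment> \<open>Since \<open>l j\<close> and \<open>l k\<close> are positive, the point stays in
    the open first quadrant and one branch of arctan gives its polar angle.\<close>
  define \<phi> where "\<phi> = (\<lambda>t. arctan (l k t / l j t))"
  have sq: "(l j t)\<^sup>2 + (l k t)\<^sup>2 = lam\<^sup>2" if "t \<in> I" for t
    using guichard[OF that ijk] lam(2)[OF that] by (simp add: gs)
  have A: "l i t = lam \<and> l j t = lam * cos (\<phi> t) \<and> l k t = lam * sin (\<phi> t)" if t: "t \<in> I" for t
  proof -
    note lj = pos[OF t, of j]
    have "1 + (l k t / l j t)\<^sup>2 = (lam / l j t)\<^sup>2" using sq[OF t] lj by (simp add: field_simps)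
    then have "sqrt (1 + (l k t / l j t)\<^sup>2) = lam / l j t" using lj lam(1) by simp
    then show ?thesis using lj lam(1) lam(2)[OF t] by (simp add: \<phi>_def cos_arctan sin_arctan)
  qed
  have d\<phi>: "(\<phi> has_real_derivative w k j t) (at t)" if t: "t \<in> I" for t
  proof -
    note lj = pos[OF t, of j] and lk = pos[OF t, of k]
    have "(\<phi> has_real_derivative inverse (1 + (l k t / l j t)\<^sup>2) *
        ((deriv (l k) t * l j t - l k t * deriv (l j) t) / (l j t * l j t))) (at t)"
      unfolding \<phi>_def
      by (rule DERIV_chain2[OF DERIV_arctan]) (use lj in \<open>intro DERIV_divide l_has_deriv t; simp\<close>)
    moreover have "inverse (1 + (l k t / l j t)\<^sup>2) *
        ((deriv (l k) t * l j t - l k t * deriv (l j) t) / (l j t * l j t)) = w k j t"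
    proof -
      \<comment> \<open>The pair \<open>(l j, l k)\<close> rotates with angular speed
        \<open>w k j\<close>.\<close>
      have r: "deriv (l j) t = - w k j t * l k t" "deriv (l k) t = w k j t * l j t"
        using w_relation[OF t] lj lk by (auto simp: gs w_def field_simps)
      have "inverse (1 + (l k t / l j t)\<^sup>2) = (l j t * l j t) / ((l j t)\<^sup>2 + (l k t)\<^sup>2)"
        using lj by (simp add: field_simps power2_eq_square)
      moreover have "deriv (l k) t * l j t - l k t * deriv (l j) t = w k j t * ((l j t)\<^sup>2 + (l k t)\<^sup>2)"
        unfolding r by algebra
      moreover have "(l j t)\<^sup>2 + (l k t)\<^sup>2 \<noteq> 0" using lj by (simp add: sum_power2_eq_zero_iff)
      ultimately show ?thesis using lj by simp
    qed
    ultimately show ?thesis by simp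
  qed
  obtain K where K: "\<And>t. t \<in> I \<Longrightarrow> w k j t * ((p j t)\<^sup>2 + (-1) * (p k t)\<^sup>2) = K"
    using first_integral[of "-1"] gs by auto
  have K': "w k j t * ((p j t - p k t) * (p j t + p k t)) = K" if "t \<in> I" for t
    using K[OF that] by (simp add: power2_eq_square algebra_simps)
  show thesis
  proof (cases "K = 0")
    case False
    have "p j t - p k t \<noteq> 0 \<and> p j t + p k t \<noteq> 0 \<and>
        (\<phi> has_real_derivative K / ((p j t - p k t) * (p j t + p k t))) (at t)" if t: "t \<in> I" for t
    proof -
      have n: "p j t - p k t \<noteq> 0" "p j t + p k t \<noteq> 0" using K'[OF t] False by auto
      then have "w k j t = K / ((p j t - p k t) * (p j t + p k t))"
        using K'[OF t] by (simp add: nonzero_eq_divide_eq)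
      then show ?thesis using n d\<phi>[OF t] by simp
    qed
    then show thesis using that[OF A, of K] by blast
  next
    case True
    define Z where "Z = {t. p j t = p k t} \<union> {t. p j t = - p k t}"
    \<comment> \<open>\<open>p j - r * p k\<close> is affine in \<open>t\<close>, and slope zero
      would force \<open>\<Delta> = 0\<close>. The values \<open>r = 1\<close> and
      \<open>r = -1\<close> give the two parts of \<open>Z\<close>.\<close>
    have unique: "t = t'" if "p j t = r * p k t" "p j t' = r * p k t'" for r t t'
    proof -
      have "(r * b $ k - b $ j) * p k t = \<Delta>" using p_Delta[of t] that(1) by (simp add: algebra_simps)
      moreover have "(r * b $ k - b $ j) * (t - t') = 0" using that unfolding p_def by algebra
      ultimately show ?thesis using Delta_nonzero by auto
    qed
    have "finite {t. p j t = r * p k t}" for r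
    proof (cases "{t. p j t = r * p k t} = {}")
      case False
      then obtain t0 where "p j t0 = r * p k t0" by blast
      then have "{t. p j t = r * p k t} \<subseteq> {t0}" using unique by blast
      then show ?thesis using finite_subset by blast
    qed simp
    from this[of 1] this[of "-1"] have "finite Z" by (simp add: Z_def)
    have w0: "w k j t = 0" if "t \<in> I - Z" for t
      using K'[of t] True that by (auto simp: Z_def)
    have "\<exists>c. \<forall>t\<in>I. \<phi> t = c"
    proof -
      \<comment> \<open>Off the finite set \<open>Z\<close> the derivative is zero; continuity
        carries the constant value across \<open>Z\<close>.\<close>
      have "continuous_on I \<phi>"
        using d\<phi> by (meson DERIV_continuous_on has_field_derivative_at_within)
      moreover have "(\<phi> has_derivative (\<lambda>h. 0)) (at t within I)" if "t \<in> I - Z" for t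
        using d\<phi>[of t] w0[OF that] that has_field_derivative_at_within[of \<phi> 0 t I]
        by (simp add: has_field_derivative_def lambda_zero)
      ultimately show ?thesis
        using has_derivative_zero_connected_constant_on[of I Z \<phi>] interval_I open_I \<open>finite Z\<close>
        by (auto simp: constant_on_def is_interval_connected)
    qed
    then show thesis using that[OF A, of 0] by blast
  qed
qed

text \<open>For equal \<open>b\<close> components the factor \<open>p j - p k\<close> is constant
  and \<open>p j + p k\<close> has slope \<open>- 2 * b $ j\<close>, so the integrand has a single
  simple pole. The nonconstant case takes \<open>D0 = K\<close>.\<close>

lemma trigonometric_case_equal:
  assumes "(\<exists>c. \<forall>t\<in>I. \<phi> t = c) \<or>
     (\<forall>t\<in>I. p j t - p k t \<noteq> 0 \<and> p j t + p k t \<noteq> 0 \<and>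
        (\<phi> has_real_derivative K / ((p j t - p k t) * (p j t + p k t))) (at t))"
    and b: "b $ j = b $ k"
  shows "\<exists>D0 D1. \<forall>t\<in>I. \<phi> t =
    D0 / (2 * b $ j * (a $ k - a $ j)) * ln \<bar>2 * b $ j * t - a $ j - a $ k\<bar> + D1"
  using assms(1)
proof
  assume "\<exists>c. \<forall>t\<in>I. \<phi> t = c"
  then obtain c where "\<forall>t\<in>I. \<phi> t = c" by blast
  \<comment> \<open>Coefficient 0 removes the logarithm, also where its argument vanishes.\<close>
  then show ?thesis by (intro exI[of _ 0] exI[of _ c]) simp
next
  assume *: "\<forall>t\<in>I. p j t - p k t \<noteq> 0 \<and> p j t + p k t \<noteq> 0 \<and>
        (\<phi> has_real_derivative K / ((p j t - p k t) * (p j t + p k t))) (at t)"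
  have bj: "b $ j \<noteq> 0" using b_nonzero b by auto
  have ak: "a $ k - a $ j \<noteq> 0" using Delta_nonzero b by (auto simp: \<Delta>_def)
  have "((\<lambda>t. K / (2 * b $ j * (a $ k - a $ j)) * ln \<bar>2 * b $ j * t - a $ j - a $ k\<bar>)
      has_real_derivative K / ((p j t - p k t) * (p j t + p k t))) (at t)" if t: "t \<in> I" for t
  proof -
    have s: "2 * b $ j * t - a $ j - a $ k = - (p j t + p k t)" by (simp add: p_def b)
    have d: "p j t - p k t = - (a $ k - a $ j)" by (simp add: p_def b)
    have n: "2 * b $ j * t - a $ j - a $ k \<noteq> 0" using * t s by auto
    have "((\<lambda>t. ln \<bar>2 * b $ j * t - a $ j - a $ k\<bar>) has_real_derivative
        1 / (2 * b $ j * t - a $ j - a $ k) * (2 * b $ j)) (at t)"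
      by (rule DERIV_chain2[OF DERIV_ln_abs]) (use n in \<open>auto intro!: derivative_eq_intros\<close>)
    from DERIV_cmult[OF this, of "K / (2 * b $ j * (a $ k - a $ j))"]
    show ?thesis
    proof (rule DERIV_cong)
      show "K / (2 * b $ j * (a $ k - a $ j)) * (1 / (2 * b $ j * t - a $ j - a $ k) * (2 * b $ j))
          = K / ((p j t - p k t) * (p j t + p k t))"
        using bj ak n unfolding d s by simp (simp add: algebra_simps)
    qed
  qed
  from equal_derivatives_on_interval[OF interval_I _ this, of \<phi>] * show ?thesis by metis
qed

text \<open>The logarithm of the quotient of the two linear factors has derivative
  \<open>- 2 * \<Delta>\<close> over their product, so the nonconstant case takes
  \<open>D2 = - K\<close>.\<close>

lemma trigonometric_case_unequal:
  assumes "(\<exists>c. \<forall>t\<in>I. \<phi> t = c) \<or>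
     (\<forall>t\<in>I. p j t - p k t \<noteq> 0 \<and> p j t + p k t \<noteq> 0 \<and>
        (\<phi> has_real_derivative K / ((p j t - p k t) * (p j t + p k t))) (at t))"
  shows "\<exists>D2 D3. \<forall>t\<in>I. \<phi> t = D2 / (2 * \<Delta>) *
    ln \<bar>((b $ k + b $ j) * t - (a $ k + a $ j)) / ((b $ k - b $ j) * t - (a $ k - a $ j))\<bar> + D3"
  using assms(1)
proof
  assume "\<exists>c. \<forall>t\<in>I. \<phi> t = c"
  then obtain c where "\<forall>t\<in>I. \<phi> t = c" by blast
  then show ?thesis by (intro exI[of _ 0] exI[of _ c]) simp
next
  assume *: "\<forall>t\<in>I. p j t - p k t \<noteq> 0 \<and> p j t + p k t \<noteq> 0 \<and>
        (\<phi> has_real_derivative K / ((p j t - p k t) * (p j t + p k t))) (at t)"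
  let ?s = "\<lambda>t. p j t + p k t" and ?d = "\<lambda>t. p j t - p k t"
  have sd: "(b $ k + b $ j) * t - (a $ k + a $ j) = - ?s t"
    "(b $ k - b $ j) * t - (a $ k - a $ j) = ?d t" for t
    by (simp_all add: p_def algebra_simps)
  have "((\<lambda>t. - K / (2 * \<Delta>) * ln \<bar>- ?s t / ?d t\<bar>)
      has_real_derivative K / (?d t * ?s t)) (at t)" if t: "t \<in> I" for t
  proof -
    have n: "?s t \<noteq> 0" "?d t \<noteq> 0" using * t by auto
    have dp: "(p n has_real_derivative - b $ n) (at t)" for n
      unfolding p_def[abs_def] by (auto intro!: derivative_eq_intros)
    have "((\<lambda>t. - ?s t / ?d t) has_real_derivative
        ((b $ j + b $ k) * ?d t - (- ?s t) * (b $ k - b $ j)) / (?d t * ?d t)) (at t)"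
      by (rule DERIV_divide) (use n in \<open>auto intro!: derivative_eq_intros dp\<close>)
    also have "(b $ j + b $ k) * ?d t - (- ?s t) * (b $ k - b $ j) = 2 * \<Delta>"
      unfolding p_Delta[of t, symmetric] by algebra
    finally have "((\<lambda>t. ln \<bar>- ?s t / ?d t\<bar>) has_real_derivative
        1 / (- ?s t / ?d t) * (2 * \<Delta> / (?d t * ?d t))) (at t)"
      by (intro DERIV_chain2[OF DERIV_ln_abs]) (use n in auto)
    from DERIV_cmult[OF this, of "- K / (2 * \<Delta>)"]
    show ?thesis
    proof (rule DERIV_cong)
      show "- K / (2 * \<Delta>) * (1 / (- ?s t / ?d t) * (2 * \<Delta> / (?d t * ?d t))) = K / (?d t * ?s t)"
        using n Delta_nonzero by (simp add: divide_simps) (simp add: algebra_simps)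
    qed
  qed
  from equal_derivatives_on_interval[OF interval_I _ this, of \<phi>] * obtain c where
    "\<And>t. t \<in> I \<Longrightarrow> \<phi> t = - K / (2 * \<Delta>) * ln \<bar>- ?s t / ?d t\<bar> + c" by metis
  then show ?thesis unfolding sd by blast
qed

end

section \<open>The three cases of the classification\<close>

theorem theorem5:
  fixes a b :: "real ^ 3" and l :: "3 \<Rightarrow> real \<Rightarrow> real"
    and U :: "(real ^ 3) set" and I :: "real set"
  assumes "a \<noteq> b" and "independent {a, b}"
    and "open U" and "\<forall>x\<in>U. b $ 1 * x $ 1 + b $ 2 * x $ 2 + b $ 3 * x $ 3 \<noteq> 0"
    and "open I" and "is_interval I" and "eta a b ` U = I"
    and "\<forall>i. smooth_real_on (l i) I" and "\<forall>i. \<forall>\<eta>\<in>I. l i \<eta> > 0"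
    and "lame_guichard_on (\<lambda>i x. l i (eta a b x)) U"
    and "\<exists>s. (a $ s, b $ s) = (0, 0)"
  shows
    "((a $ 1, b $ 1) = (0, 0) \<longrightarrow>
       (\<forall>x\<in>U. eta a b x = (a $ 2 * x $ 2 + a $ 3 * x $ 3) / (b $ 2 * x $ 2 + b $ 3 * x $ 3)) \<and>
       (\<exists>lam1 \<phi>.
          (\<forall>\<eta>\<in>I. l 1 \<eta> = lam1 \<and> l 2 \<eta> = lam1 * cosh (\<phi> \<eta>) \<and> l 3 \<eta> = lam1 * sinh (\<phi> \<eta>)) \<and>
          (\<exists>C0 C1. \<forall>\<eta>\<in>I. \<phi> \<eta> =
             C0 / (a $ 2 * b $ 3 - a $ 3 * b $ 2) *
               arctan (((b $ 2)\<^sup>2 + (b $ 3)\<^sup>2) / (a $ 3 * b $ 2 - a $ 2 * b $ 3) *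
                 (\<eta> - (a $ 2 * b $ 2 + a $ 3 * b $ 3) / ((b $ 2)\<^sup>2 + (b $ 3)\<^sup>2))) + C1)))
     \<and> ((a $ 2, b $ 2) = (0, 0) \<longrightarrow>
       (\<forall>x\<in>U. eta a b x = (a $ 1 * x $ 1 + a $ 3 * x $ 3) / (b $ 1 * x $ 1 + b $ 3 * x $ 3)) \<and>
       (\<exists>lam2 \<phi>.
          (\<forall>\<eta>\<in>I. l 2 \<eta> = lam2 \<and> l 1 \<eta> = lam2 * cos (\<phi> \<eta>) \<and> l 3 \<eta> = lam2 * sin (\<phi> \<eta>)) \<and>
          (b $ 1 = b $ 3 \<longrightarrow>
            (\<exists>D0 D1. \<forall>\<eta>\<in>I. 2 * b $ 1 * \<eta> - a $ 1 - a $ 3 \<noteq> 0 \<longrightarrow> \<phi> \<eta> =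
               D0 / (2 * b $ 1 * (a $ 3 - a $ 1)) * ln \<bar>2 * b $ 1 * \<eta> - a $ 1 - a $ 3\<bar> + D1)) \<and>
          (b $ 1 \<noteq> b $ 3 \<longrightarrow>
            (\<exists>D2 D3. \<forall>\<eta>\<in>I.
               (b $ 3 - b $ 1) * \<eta> - (a $ 3 - a $ 1) \<noteq> 0 \<and>
               (b $ 3 + b $ 1) * \<eta> - (a $ 3 + a $ 1) \<noteq> 0 \<longrightarrow> \<phi> \<eta> =
               D2 / (2 * (a $ 1 * b $ 3 - a $ 3 * b $ 1)) *
                 ln \<bar>((b $ 3 + b $ 1) * \<eta> - (a $ 3 + a $ 1)) /
                     ((b $ 3 - b $ 1) * \<eta> - (a $ 3 - a $ 1))\<bar> + D3))))
     \<and> ((a $ 3, b $ 3) = (0, 0) \<longrightarrow>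
       (\<forall>x\<in>U. eta a b x = (a $ 1 * x $ 1 + a $ 2 * x $ 2) / (b $ 1 * x $ 1 + b $ 2 * x $ 2)) \<and>
       (\<exists>lam3 \<phi>.
          (\<forall>\<eta>\<in>I. l 3 \<eta> = lam3 \<and> l 2 \<eta> = lam3 * cosh (\<phi> \<eta>) \<and> l 1 \<eta> = lam3 * sinh (\<phi> \<eta>)) \<and>
          (\<exists>E0 E1. \<forall>\<eta>\<in>I. \<phi> \<eta> =
             E0 / (a $ 2 * b $ 1 - a $ 1 * b $ 2) *
               arctan (((b $ 2)\<^sup>2 + (b $ 1)\<^sup>2) / (a $ 2 * b $ 1 - a $ 1 * b $ 2) *
                 (\<eta> - (a $ 2 * b $ 2 + a $ 1 * b $ 1) / ((b $ 2)\<^sup>2 + (b $ 1)\<^sup>2))) + E1)))"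
proof (intro conjI impI)
  have sol: "lame_solution a b l U I"
  proof
    show "b \<bullet> x \<noteq> 0" if "x \<in> U" for x
      using assms(4) that by (simp add: inner_vec_def sum_3)
  qed (use assms in blast)+
  {
    assume 0: "(a $ 1, b $ 1) = (0, 0)"
    show "\<forall>x\<in>U. eta a b x = (a $ 2 * x $ 2 + a $ 3 * x $ 3) / (b $ 2 * x $ 2 + b $ 3 * x $ 3)"
      using 0 by (simp add: eta_def)
    interpret lame_solution a b l U I by (rule sol)
    \<comment> \<open>Index 2 has the negative sign, so \<open>l 2\<close> is the largest
      coefficient and takes the role \<open>j\<close> of the cosh.\<close>
    interpret degenerate_lame_solution a b l U I 1 2 3
      by unfold_locales (use 0 in auto)
    obtain lam \<phi> C c where A:
      "\<And>t. t \<in> I \<Longrightarrow> l 1 t = lam \<and> l 2 t = lam * cosh (\<phi> t) \<and> l 3 t = lam * sinh (\<phi> t)"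
      and B: "\<And>t. t \<in> I \<Longrightarrow> \<phi> t = C / \<Delta> * arctan (((b $ 2)\<^sup>2 + (b $ 3)\<^sup>2) / \<Delta> *
       (t - (a $ 2 * b $ 2 + a $ 3 * b $ 3) / ((b $ 2)\<^sup>2 + (b $ 3)\<^sup>2))) + c"
      by (rule hyperbolic_case) (auto simp: guichard_sign_def)
    have D: "a $ 2 * b $ 3 - a $ 3 * b $ 2 = \<Delta>" "a $ 3 * b $ 2 - a $ 2 * b $ 3 = - \<Delta>"
      by (simp_all add: \<Delta>_def)
    show "\<exists>lam1 \<phi>.
          (\<forall>\<eta>\<in>I. l 1 \<eta> = lam1 \<and> l 2 \<eta> = lam1 * cosh (\<phi> \<eta>) \<and> l 3 \<eta> = lam1 * sinh (\<phi> \<eta>)) \<and>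
          (\<exists>C0 C1. \<forall>\<eta>\<in>I. \<phi> \<eta> =
             C0 / (a $ 2 * b $ 3 - a $ 3 * b $ 2) *
               arctan (((b $ 2)\<^sup>2 + (b $ 3)\<^sup>2) / (a $ 3 * b $ 2 - a $ 2 * b $ 3) *
                 (\<eta> - (a $ 2 * b $ 2 + a $ 3 * b $ 3) / ((b $ 2)\<^sup>2 + (b $ 3)\<^sup>2))) + C1)"
      unfolding D
    proof (rule exI[of _ lam], rule exI[of _ \<phi>], rule conjI, goal_cases)
      case 1
      show ?case using A by blast
    next
      case 2
      \<comment> \<open>The stated formula has \<Delta> outside and \<open>- \<Delta>\<close> inside
        the arctangent; oddness turns this into the sign of the constant.\<close>
      show ?case
        by (rule exI[of _ "- C"], rule exI[of _ c]) (simp add: B arctan_minus)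
    qed
  }
  {
    assume 0: "(a $ 2, b $ 2) = (0, 0)"
    show "\<forall>x\<in>U. eta a b x = (a $ 1 * x $ 1 + a $ 3 * x $ 3) / (b $ 1 * x $ 1 + b $ 3 * x $ 3)"
      using 0 by (simp add: eta_def)
    interpret lame_solution a b l U I by (rule sol)
    \<comment> \<open>The remaining signs are equal, so the pair lies on a circle; the order 1, 3
      gives the cosine to \<open>l 1\<close>.\<close>
    interpret degenerate_lame_solution a b l U I 2 1 3
      by unfold_locales (use 0 in auto)
    obtain lam \<phi> K where A:
      "\<And>t. t \<in> I \<Longrightarrow> l 2 t = lam \<and> l 1 t = lam * cos (\<phi> t) \<and> l 3 t = lam * sin (\<phi> t)"
      and B: "(\<exists>c. \<forall>t\<in>I. \<phi> t = c) \<or>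
     (\<forall>t\<in>I. p 1 t - p 3 t \<noteq> 0 \<and> p 1 t + p 3 t \<noteq> 0 \<and>
        (\<phi> has_real_derivative K / ((p 1 t - p 3 t) * (p 1 t + p 3 t))) (at t))"
      by (rule trigonometric_case) (auto simp: guichard_sign_def)
    show "\<exists>lam2 \<phi>.
          (\<forall>\<eta>\<in>I. l 2 \<eta> = lam2 \<and> l 1 \<eta> = lam2 * cos (\<phi> \<eta>) \<and> l 3 \<eta> = lam2 * sin (\<phi> \<eta>)) \<and>
          (b $ 1 = b $ 3 \<longrightarrow>
            (\<exists>D0 D1. \<forall>\<eta>\<in>I. 2 * b $ 1 * \<eta> - a $ 1 - a $ 3 \<noteq> 0 \<longrightarrow> \<phi> \<eta> =
               D0 / (2 * b $ 1 * (a $ 3 - a $ 1)) * ln \<bar>2 * b $ 1 * \<eta> - a $ 1 - a $ 3\<bar> + D1)) \<and>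
          (b $ 1 \<noteq> b $ 3 \<longrightarrow>
            (\<exists>D2 D3. \<forall>\<eta>\<in>I.
               (b $ 3 - b $ 1) * \<eta> - (a $ 3 - a $ 1) \<noteq> 0 \<and>
               (b $ 3 + b $ 1) * \<eta> - (a $ 3 + a $ 1) \<noteq> 0 \<longrightarrow> \<phi> \<eta> =
               D2 / (2 * (a $ 1 * b $ 3 - a $ 3 * b $ 1)) *
                 ln \<bar>((b $ 3 + b $ 1) * \<eta> - (a $ 3 + a $ 1)) /
                     ((b $ 3 - b $ 1) * \<eta> - (a $ 3 - a $ 1))\<bar> + D3))"
    proof (rule exI[of _ lam], rule exI[of _ \<phi>], intro conjI impI, goal_cases)
      case 1
      show ?case using A by blast
    next
      case 2
      show ?case using trigonometric_case_equal[OF B 2] by blast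
    next
      case 3
      show ?case using trigonometric_case_unequal[OF B] unfolding \<Delta>_def by blast
    qed
  }
  {
    assume 0: "(a $ 3, b $ 3) = (0, 0)"
    show "\<forall>x\<in>U. eta a b x = (a $ 1 * x $ 1 + a $ 2 * x $ 2) / (b $ 1 * x $ 1 + b $ 2 * x $ 2)"
      using 0 by (simp add: eta_def)
    interpret lame_solution a b l U I by (rule sol)
    \<comment> \<open>In this order \<Delta> is \<open>a $ 2 * b $ 1 - a $ 1 * b $ 2\<close>, the
      denominator in both places, so the constant keeps its sign.\<close>
    interpret degenerate_lame_solution a b l U I 3 2 1
      by unfold_locales (use 0 in auto)
    obtain lam \<phi> C c where A:
      "\<And>t. t \<in> I \<Longrightarrow> l 3 t = lam \<and> l 2 t = lam * cosh (\<phi> t) \<and> l 1 t = lam * sinh (\<phi> t)"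
      and B: "\<And>t. t \<in> I \<Longrightarrow> \<phi> t = C / \<Delta> * arctan (((b $ 2)\<^sup>2 + (b $ 1)\<^sup>2) / \<Delta> *
       (t - (a $ 2 * b $ 2 + a $ 1 * b $ 1) / ((b $ 2)\<^sup>2 + (b $ 1)\<^sup>2))) + c"
      by (rule hyperbolic_case) (auto simp: guichard_sign_def)
    show "\<exists>lam3 \<phi>.
          (\<forall>\<eta>\<in>I. l 3 \<eta> = lam3 \<and> l 2 \<eta> = lam3 * cosh (\<phi> \<eta>) \<and> l 1 \<eta> = lam3 * sinh (\<phi> \<eta>)) \<and>
          (\<exists>E0 E1. \<forall>\<eta>\<in>I. \<phi> \<eta> =
             E0 / (a $ 2 * b $ 1 - a $ 1 * b $ 2) *
               arctan (((b $ 2)\<^sup>2 + (b $ 1)\<^sup>2) / (a $ 2 * b $ 1 - a $ 1 * b $ 2) *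
                 (\<eta> - (a $ 2 * b $ 2 + a $ 1 * b $ 1) / ((b $ 2)\<^sup>2 + (b $ 1)\<^sup>2))) + E1)"
    proof (rule exI[of _ lam], rule exI[of _ \<phi>], rule conjI, goal_cases)
      case 1
      show ?case using A by blast
    next
      case 2
      show ?case
        by (rule exI[of _ C], rule exI[of _ c]) (simp add: B \<Delta>_def)
    qed
  }
qed

end
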